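(* Let $M=(m_{ij})_{i,j\ge1}$ be a nuclear matrix over $\mathbb{C}_p$, let $g\in\mathrm{Gal}(\bar{\mathbb{Q}}_p/\mathbb{Q}_p)$, let $a\ge1$ be an integer, fix $k\in\mathbb{Z}_{\ge1}$, and let $C_k$ be the coefficient of $T^k$ in $\det(1-(M^{g^{a-1}}\cdots M^gM)T)$. Let $h_1\le h_2\le\cdots$ be a nondecreasing sequence of real numbers with $h_i\le\inf_{j\ge1}\mathrm{ord}_pm_{ij}$ for all $i\ge1$. Consider: (i) $\mathrm{ord}_p\det M^{[k]}<\sum_{1\le i\le k}h_i+\frac{h_{k+1}-h_k}{2}$; (ii) $\mathrm{ord}_qC_k<\sum_{1\le i\le k}h_i+\frac{h_{k+1}-h_k}{2}$; (iii) $\mathrm{ord}_qC_k=\mathrm{ord}_p\det M^{[k]}$. Then (i) and (ii) are equivalent, and each implies (iii).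
   Context: $\mathbb{C}_p$ is the completion of $\bar{\mathbb{Q}}_p$; $g$ acts continuously on $\mathbb{C}_p$ and $M^{g}$ denotes entrywise application of $g$. A matrix $M=(m_{ij})_{i,j\ge1}$ over $\mathbb{C}_p$ is nuclear if $\lim_{i\to\infty}\inf_{j\ge1}\mathrm{ord}_pm_{ij}=+\infty$; $\det(1-NT)$ is the Fredholm determinant of a nuclear matrix $N$ (coefficient of $T^k$ equal to $(-1)^k$ times the sum of principal $k\times k$ minors). $M^{[k]}$ is the submatrix of the first $k$ rows and columns. $q=p^a$ and $\mathrm{ord}_q=\mathrm{ord}_p/a$. *)

theory Defs
  imports
    "HOL-Analysis.Infinite_Sum"
    "HOL-Library.Extended_Real"
    "HOL-Computational_Algebra.Formal_Power_Series"
    "Jordan_Normal_Form.Determinant"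
begin

section \<open>The field \<open>\<complex>\<^sub>p\<close>\<close>

text \<open>
  The field of \<open>p\<close>-adic complex numbers is described as a complete metric field whose metric is
  given by a valuation \<open>ord\<close> with \<open>ord p = 1\<close>, and in which the algebraic closure of
  \<open>\<rat>\<^sub>p\<close> is dense.
  Inside such a field, \<open>\<rat>\<^sub>p\<close> is the topological closure of \<open>\<rat>\<close>: since the field is complete,
  this is the completion of \<open>\<rat>\<close> for the metric induced on it, which is the \<open>p\<close>-adic one.
\<close>

definition Qp :: "'k :: {field_char_0, topological_space} set"
  where "Qp = closure \<rat>"

definition Qp_bar :: "'k :: {field_char_0, topological_space} set"
  where "Qp_bar = {x. \<exists>f. f \<noteq> 0 \<and> (\<forall>i. coeff f i \<in> Qp) \<and> poly f x = 0}"

text \<open>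
  The last two assumptions say that the field is the completion of an algebraic closure of
  \<open>\<rat>\<^sub>p\<close>: the elements algebraic over \<open>\<rat>\<^sub>p\<close> form an algebraically closed field, and they are
  dense in the complete field. This determines the valued field up to isometric isomorphism.
\<close>

locale padic_complex_numbers =
  fixes p :: nat and ord :: "'k :: {field_char_0, complete_space} \<Rightarrow> ereal"
  assumes prime_p: "prime p"
    and ord_not_MInfty: "ord x \<noteq> -\<infinity>"
    and ord_eq_PInfty_iff: "ord x = \<infinity> \<longleftrightarrow> x = 0"
    and ord_mult: "ord (x * y) = ord x + ord y"
    and ord_add: "min (ord x) (ord y) \<le> ord (x + y)"
    and ord_p: "ord (of_nat p) = 1"
    and dist_ord: "x \<noteq> y \<Longrightarrow> dist x y = real p powr (- real_of_ereal (ord (x - y)))"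
    and Qp_bar_alg_closed:
      "degree f > 0 \<Longrightarrow> (\<And>i. coeff f i \<in> (Qp_bar :: 'k set)) \<Longrightarrow>
        \<exists>x\<in>Qp_bar. poly f x = 0"
    and Qp_bar_dense: "closure Qp_bar = (UNIV :: 'k set)"

text \<open>
  The elements of the Galois group of \<open>Qp_bar\<close> over \<open>Qp\<close>. Only the values of \<open>\<sigma>\<close> on \<open>Qp_bar\<close> matter.
\<close>

definition galois_Qp :: "('k :: {field_char_0, topological_space} \<Rightarrow> 'k) \<Rightarrow> bool"
  where "galois_Qp \<sigma> \<longleftrightarrow>
    bij_betw \<sigma> Qp_bar Qp_bar \<and>
    (\<forall>x\<in>Qp_bar. \<forall>y\<in>Qp_bar. \<sigma> (x + y) = \<sigma> x + \<sigma> y \<and> \<sigma> (x * y) = \<sigma> x * \<sigma> y) \<and>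
    (\<forall>x\<in>Qp. \<sigma> x = x)"

text \<open>
  \<open>g\<close> is the action of \<open>\<sigma>\<close> on \<open>\<complex>\<^sub>p\<close>, i.e. the continuous extension of \<open>\<sigma>\<close>. It is unique because
  \<open>Qp_bar\<close> is dense.
\<close>

definition is_Cp_action ::
    "('k :: {field_char_0, topological_space} \<Rightarrow> 'k) \<Rightarrow> ('k \<Rightarrow> 'k) \<Rightarrow> bool"
  where "is_Cp_action \<sigma> g \<longleftrightarrow> continuous_on UNIV g \<and> (\<forall>x\<in>Qp_bar. g x = \<sigma> x)"


section \<open>Infinite matrices\<close>

text \<open>
  An infinite matrix \<open>(m\<^sub>i\<^sub>j)\<close> with \<open>i, j \<ge> 1\<close> is a function of two natural numbers. Its values at
  index \<open>0\<close> are never used.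
\<close>

type_synonym 'k inf_matrix = "nat \<Rightarrow> nat \<Rightarrow> 'k"

definition row_ord :: "('k \<Rightarrow> ereal) \<Rightarrow> 'k inf_matrix \<Rightarrow> nat \<Rightarrow> ereal"
  where "row_ord ord M i = (INF j\<in>{1..}. ord (M i j))"

definition nuclear :: "('k \<Rightarrow> ereal) \<Rightarrow> 'k inf_matrix \<Rightarrow> bool"
  where "nuclear ord M \<longleftrightarrow> row_ord ord M \<longlonglongrightarrow> \<infinity>"

definition inf_matrix_mult ::
    "'k :: {semiring_0, t2_space} inf_matrix \<Rightarrow> 'k inf_matrix \<Rightarrow> 'k inf_matrix"
  where "inf_matrix_mult A B = (\<lambda>i j. \<Sum>\<^sub>\<infinity>l\<in>{1..}. A i l * B l j)"

definition map_inf_matrix :: "('k \<Rightarrow> 'k) \<Rightarrow> 'k inf_matrix \<Rightarrow> 'k inf_matrix"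
  where "map_inf_matrix g M = (\<lambda>i j. g (M i j))"

text \<open>\<open>twisted_product g M n\<close> is the product of \<open>n + 1\<close> factors \<open>(g ^^ n)(M) \<cdots> g(M) M\<close>,
  where \<open>g\<close> acts entrywise.\<close>

primrec twisted_product ::
    "('k :: {semiring_0, t2_space} \<Rightarrow> 'k) \<Rightarrow> 'k inf_matrix \<Rightarrow> nat \<Rightarrow> 'k inf_matrix"
  where
    "twisted_product g M 0 = M"
  | "twisted_product g M (Suc n) =
       inf_matrix_mult (map_inf_matrix (g ^^ Suc n) M) (twisted_product g M n)"

text \<open>Matrices of type \<open>mat\<close> are indexed from \<open>0\<close>, hence the shift.\<close>

definition leading_submatrix :: "'k inf_matrix \<Rightarrow> nat \<Rightarrow> 'k mat"
  where "leading_submatrix M k = mat k k (\<lambda>(i, j). M (Suc i) (Suc j))"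

definition principal_submatrix :: "'k inf_matrix \<Rightarrow> nat set \<Rightarrow> 'k mat"
  where "principal_submatrix M S =
    mat (card S) (card S) (\<lambda>(i, j). M (sorted_list_of_set S ! i) (sorted_list_of_set S ! j))"

text \<open>The power series \<open>det(1 - N T)\<close> in \<open>T\<close>.\<close>

definition fredholm_det :: "'k :: {comm_ring_1, t2_space} inf_matrix \<Rightarrow> 'k fps"
  where "fredholm_det N = Abs_fps (\<lambda>k. (- 1) ^ k *
    (\<Sum>\<^sub>\<infinity>S\<in>{S. S \<subseteq> {1..} \<and> finite S \<and> card S = k}. det (principal_submatrix N S)))"

end

theory Submission
  imports Defs "HOL-Analysis.Elementary_Metric_Spaces"
begin

text \<open>
  Write \<open>D\<close> for the leading \<open>k \<times> k\<close> minor of \<open>M\<close>, \<open>H = h\<^sub>1 + \<dots> + h\<^sub>k\<close>, \<open>\<delta> = h\<^sub>k\<^sub>+\<^sub>1 - h\<^sub>k\<close> and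
  \<open>b = H + \<delta> / 2\<close>. By the Cauchy--Binet formula, \<open>\<plusminus> C\<^sub>k\<close> is the trace of the product of the
  Galois conjugates of the \<open>k\<close>-th compound matrix of \<open>M\<close>. An entry \<open>(S, T)\<close> of the compound
  matrix has valuation at least the sum of \<open>h\<close> over \<open>S\<close>, which is at least \<open>H\<close>, and at least
  \<open>H + \<delta>\<close> if \<open>S\<close> is not the initial segment \<open>K = {1..k}\<close>. Conjugating by the weight
  \<open>w(S) = \<delta> / 2\<close> for \<open>S \<noteq> K\<close>, \<open>w(K) = 0\<close>, turns this into the uniform bound \<open>b\<close> for all entries
  except the entry \<open>D\<close> at \<open>(K, K)\<close>. Hence, up to the product of the \<open>a\<close> conjugates of \<open>D\<close>, the
  trace has valuation at least \<open>b + (a - 1) min(b, ord D)\<close>, from which everything follows.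
  The infinite sums are handled modulo high powers of \<open>p\<close>, where they become finite.
\<close>

section \<open>The Cauchy--Binet formula\<close>

lemma det_mat_expand:
  "det (mat n n (\<lambda>(i, j). f i j)) =
    (\<Sum>\<pi> | \<pi> permutes {0..<n}. signof \<pi> * (\<Prod>i = 0..<n. f i (\<pi> i)))"
  unfolding det_def by (auto intro!: sum.cong prod.cong dest: permutes_in_image)

text \<open>Multilinearity in the rows expands the left side over all maps \<open>f\<close> from row
  indices to \<open>V\<close>. A repeated value of \<open>f\<close> produces two equal rows. An
  injective \<open>f\<close> is in a unique way a permutation followed by the increasing enumeration
  of its image \<open>U\<close>; for fixed \<open>U\<close> the permutations add up to the
  determinant of the \<open>A\<close> part.\<close>

lemma det_mat_sum_mult:
  fixes A :: "nat \<Rightarrow> 'l::linorder \<Rightarrow> 'a::comm_ring_1"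
  assumes V: "finite V"
  shows "det (mat k k (\<lambda>(i, j). \<Sum>l\<in>V. A i l * B l j)) =
    (\<Sum>U | U \<subseteq> V \<and> card U = k.
      det (mat k k (\<lambda>(i, j). A i (sorted_list_of_set U ! j))) *
      det (mat k k (\<lambda>(i, j). B (sorted_list_of_set U ! i) j)))"
    (is "det ?L = (\<Sum>U\<in>?W. det (?A U) * det (?B U))")
proof -
  define K where "K = {0..<k}"
  define P where "P = {p. p permutes K}"
  define F where "F = PiE K (\<lambda>_. V)"
  define D where "D f = det (mat k k (\<lambda>(i, j). B (f i) j))" for f :: "nat \<Rightarrow> 'l"
  define t where "t f = (\<Prod>i\<in>K. A i (f i)) * D f" for f :: "nat \<Rightarrow> 'l"
  \<comment> \<open>\<open>restrict\<close> makes \<open>c (U, p)\<close> extensional, so that it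
    lies in \<open>F\<close>; \<open>c\<close> is a bijection from \<open>?W \<times> P\<close> onto
    the injective members of \<open>F\<close>.\<close>
  define c where "c = (\<lambda>(U :: 'l set, p). restrict (\<lambda>i. sorted_list_of_set U ! p i) K)"
  have fin: "finite K" "finite P" "finite F" "finite ?W"
    using V by (auto simp: K_def P_def F_def intro: finite_permutations finite_PiE)
  have D: "D f = (\<Sum>p\<in>P. signof p * (\<Prod>i\<in>K. B (f i) (p i)))" for f
    unfolding D_def P_def K_def by (rule det_mat_expand)
  have D_cong: "D f = D f'" if "\<And>i. i \<in> K \<Longrightarrow> f i = f' i" for f f'
    unfolding D using that by (simp cong: prod.cong)
  have "det ?L = (\<Sum>p\<in>P. signof p * (\<Prod>i\<in>K. \<Sum>l\<in>V. A i l * B l (p i)))"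
    unfolding P_def K_def by (rule det_mat_expand)
  also have "\<dots> = (\<Sum>p\<in>P. \<Sum>f\<in>F. signof p * ((\<Prod>i\<in>K. A i (f i)) * (\<Prod>i\<in>K. B (f i) (p i))))"
    using fin V by (simp add: prod_sum_PiE F_def prod.distrib sum_distrib_left)
  also have "\<dots> = (\<Sum>f\<in>F. t f)"
    unfolding t_def D by (subst sum.swap) (simp add: sum_distrib_left mult_ac)
  also have "\<dots> = (\<Sum>f | f \<in> F \<and> inj_on f K. t f)"
  proof (rule sum.mono_neutral_right)
    show "\<forall>f\<in>F - {f \<in> F. inj_on f K}. t f = 0"
    proof
      fix f assume "f \<in> F - {f \<in> F. inj_on f K}"
      then obtain i j where ij: "i < k" "j < k" "i \<noteq> j" "f i = f j"
        by (auto simp: inj_on_def K_def)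
      have "D f = 0"
        unfolding D_def by (rule det_identical_rows[OF _ ij(3,1,2)]) (use ij in \<open>auto intro!: eq_vecI\<close>)
      then show "t f = 0" by (simp add: t_def)
    qed
  qed (use fin in auto)
  also have "{f. f \<in> F \<and> inj_on f K} = c ` (?W \<times> P)"
  proof (intro equalityI subsetI)
    fix f assume "f \<in> {f. f \<in> F \<and> inj_on f K}"
    then have f: "f \<in> F" "inj_on f K" by auto
    define U where "U = f ` K"
    have U: "U \<in> ?W" "finite U"
      using f card_image[of f K] by (auto simp: U_def F_def K_def)
    define u where "u = (!) (sorted_list_of_set U)"
    have u: "bij_betw u K U"
      unfolding u_def K_def using U
      by (intro bij_betw_nth) auto
    \<comment> \<open>\<open>permutes\<close> demands the identity outside \<open>K\<close>.\<close>
    define p where "p i = (if i \<in> K then inv_into K u (f i) else i)" for i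
    have "bij_betw (inv_into K u \<circ> f) K K"
      using f u by (intro bij_betw_trans[of f K U] bij_betw_inv_into)
        (auto simp: U_def bij_betw_def)
    then have "bij_betw p K K"
      by (rule bij_betw_cong[THEN iffD1, rotated]) (simp add: p_def)
    then have "p \<in> P"
      unfolding P_def by (auto intro: bij_imp_permutes simp: p_def)
    moreover have "c (U, p) = f"
    proof
      fix i
      have "c (U, p) i = restrict (\<lambda>i. u (p i)) K i" by (simp add: c_def u_def)
      moreover have "u (inv_into K u (f i)) = f i" if "i \<in> K"
        using that u by (intro f_inv_into_f) (auto simp: bij_betw_def U_def)
      ultimately show "c (U, p) i = f i"
        using f by (auto simp: p_def F_def dest: PiE_arb)
    qed
    ultimately show "f \<in> c ` (?W \<times> P)"
      using U by (intro image_eqI[of _ _ "(U, p)"]) auto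
  next
    fix f assume "f \<in> c ` (?W \<times> P)"
    then obtain U p where Up: "U \<in> ?W" "p \<in> P" "f = c (U, p)" by auto
    have "finite U" using Up V finite_subset by auto
    then have u: "bij_betw ((!) (sorted_list_of_set U)) K U"
      unfolding K_def using Up by (intro bij_betw_nth) auto
    have p: "bij_betw p K K" using Up by (simp add: P_def permutes_imp_bij)
    have "bij_betw ((!) (sorted_list_of_set U) \<circ> p) K U"
      by (rule bij_betw_trans[OF p u])
    then have "bij_betw f K U"
      by (rule bij_betw_cong[THEN iffD1, rotated]) (simp add: Up c_def)
    then show "f \<in> {f \<in> F. inj_on f K}"
      using Up by (auto simp: bij_betw_def F_def c_def)
  qed
  also have "(\<Sum>f\<in>c ` (?W \<times> P). t f) = (\<Sum>x\<in>?W \<times> P. t (c x))"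
  proof (subst sum.reindex)
    show "inj_on c (?W \<times> P)"
    proof (intro inj_onI, clarsimp)
      fix U p U' p'
      assume eq: "c (U, p) = c (U', p')" and U: "U \<subseteq> V" "k = card U"
        and U': "U' \<subseteq> V" "card U' = card U" and P: "p \<in> P" "p' \<in> P"
      have eq': "sorted_list_of_set U ! p i = sorted_list_of_set U' ! p' i" if "i \<in> K" for i
        using fun_cong[OF eq, of i] that by (simp add: c_def)
      have "finite U" "finite U'" using U U' V finite_subset by blast+
      have u: "bij_betw ((!) (sorted_list_of_set U)) K U"
        unfolding K_def using U \<open>finite U\<close> by (intro bij_betw_nth) auto
      have u': "bij_betw ((!) (sorted_list_of_set U')) K U'"
        unfolding K_def using U U' \<open>finite U'\<close> by (intro bij_betw_nth) auto
      have im: "p ` K = K" "p' ` K = K" using P by (auto simp: P_def permutes_image)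
      \<comment> \<open>Since \<open>p\<close> permutes \<open>K\<close>, the set \<open>U\<close>
        is recovered as the image of \<open>K\<close> under \<open>c (U, p)\<close>.\<close>
      have "U = (\<lambda>i. sorted_list_of_set U ! p i) ` K"
        using u im by (metis bij_betw_def image_image)
      also have "\<dots> = (\<lambda>i. sorted_list_of_set U' ! p' i) ` K"
        using eq' by (intro image_cong) auto
      also have "\<dots> = U'"
        using u' im by (metis bij_betw_def image_image)
      finally have UU: "U = U'" .
      have "p i = p' i" for i
      proof (cases "i \<in> K")
        case True
        then have "p i \<in> K" "p' i \<in> K" using im by auto
        then show ?thesis using eq'[OF True] u UU by (auto simp: bij_betw_def inj_on_def)
      next
        case False
        then show ?thesis using P by (simp add: P_def permutes_not_in)
      qed
      with UU show "U = U' \<and> p = p'" by auto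
    qed
  qed simp
  also have "\<dots> = (\<Sum>U\<in>?W. \<Sum>p\<in>P. t (c (U, p)))"
    by (simp add: sum.cartesian_product)
  also have "\<dots> = (\<Sum>U\<in>?W. det (?A U) * det (?B U))"
  proof (rule sum.cong[OF refl])
    fix U
    have "t (c (U, p)) = signof p * (\<Prod>i\<in>K. A i (sorted_list_of_set U ! p i)) * det (?B U)"
      if p: "p \<in> P" for p
    proof -
      \<comment> \<open>Up to its order of rows, \<open>D (c (U, p))\<close> is
        \<open>det (?B U)\<close>; the sign of \<open>p\<close> completes the product over
        \<open>A\<close> to a Leibniz term of \<open>det (?A U)\<close>.\<close>
      have "D (c (U, p)) = D (\<lambda>i. sorted_list_of_set U ! p i)"
        by (rule D_cong) (simp add: c_def)
      also have "\<dots> = det (mat k k (\<lambda>(i, j). ?B U $$ (p i, j)))"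
        unfolding D_def using p
        by (intro arg_cong[of _ _ det] eq_matI) (auto simp: P_def K_def permutes_in_image)
      also have "\<dots> = signof p * det (?B U)"
        using p by (intro det_permute_rows) (auto simp: P_def K_def)
      finally show ?thesis by (simp add: t_def c_def mult_ac)
    qed
    moreover have "det (?A U) = (\<Sum>p\<in>P. signof p * (\<Prod>i\<in>K. A i (sorted_list_of_set U ! p i)))"
      unfolding P_def K_def by (rule det_mat_expand)
    ultimately show "(\<Sum>p\<in>P. t (c (U, p))) = det (?A U) * det (?B U)"
      by (simp add: sum_distrib_right)
  qed
  finally show ?thesis .
qed


section \<open>Valuations and limits\<close>

context padic_complex_numbers
begin

section \<open>Valuation of sums, products and determinants\<close>

lemma ord_real: "x \<noteq> 0 \<Longrightarrow> \<exists>v. ord x = ereal v"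
  using ord_not_MInfty[of x] ord_eq_PInfty_iff[of x] by (cases "ord x") auto

lemma ord_zero [simp]: "ord 0 = \<infinity>"
  by (simp add: ord_eq_PInfty_iff)

lemma ord_one [simp]: "ord 1 = 0"
proof -
  obtain v where v: "ord 1 = ereal v" using ord_real[of 1] by auto
  have "ord 1 = ord 1 + ord 1" using ord_mult[of 1 1] by simp
  then show ?thesis using v by (simp add: zero_ereal_def)
qed

lemma ord_minus [simp]: "ord (- x) = ord x"
proof -
  obtain v where v: "ord (- 1) = ereal v" using ord_real[of "- 1"] by auto
  have "ord (- 1) + ord (- 1) = 0" using ord_mult[of "- 1" "- 1"] by simp
  then have "ord (- 1) = 0" using v by (simp add: zero_ereal_def)
  then show ?thesis using ord_mult[of "- 1" x] by simp
qed

lemma ord_signof_mult [simp]: "ord (of_int (sign \<pi>) * x) = ord x"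
  by (cases \<pi> rule: sign_cases) auto

lemma ord_minus_commute: "ord (x - y) = ord (y - x)"
  using ord_minus[of "x - y"] by simp

lemma ord_power: "ord (x ^ n) = ereal (real n) * ord x"
proof (induction n)
  case (Suc n)
  show ?case
  proof (cases "x = 0")
    case False
    then obtain v where "ord x = ereal v" using ord_real by auto
    with Suc show ?thesis by (simp add: ord_mult algebra_simps)
  qed (simp add: Suc)
qed (simp flip: zero_ereal_def)

lemma ord_inverse: "x \<noteq> 0 \<Longrightarrow> ord (inverse x) = - ord x"
proof -
  assume x: "x \<noteq> 0"
  obtain v where v: "ord x = ereal v" using ord_real x by auto
  obtain w where w: "ord (inverse x) = ereal w" using ord_real[of "inverse x"] x by auto
  have "ord x + ord (inverse x) = 0" using ord_mult[of x "inverse x"] x by simp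
  then show ?thesis using v w by (simp add: zero_ereal_def)
qed

lemma ord_add_ge: "B \<le> ord x \<Longrightarrow> B \<le> ord y \<Longrightarrow> B \<le> ord (x + y)"
  using ord_add[of x y] by (auto simp: min_def split: if_splits)

lemma ord_diff_ge: "B \<le> ord x \<Longrightarrow> B \<le> ord y \<Longrightarrow> B \<le> ord (x - y)"
  using ord_add_ge[of B x "- y"] by simp

lemma ord_diff_trans: "B \<le> ord (x - y) \<Longrightarrow> B \<le> ord (y - z) \<Longrightarrow> B \<le> ord (x - z)"
  using ord_add_ge[of B "x - y" "y - z"] by simp

text \<open>Isosceles principle: if \<open>y\<close> had larger valuation than \<open>x\<close>,
  then so would \<open>x = y - (y - x)\<close>.\<close>

lemma ord_eqI:
  assumes "ord x < ord (y - x)"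
  shows "ord y = ord x"
proof (rule antisym)
  show "ord x \<le> ord y"
    using ord_add_ge[of "ord x" "y - x" x] assms by simp
  show "ord y \<le> ord x"
  proof (rule ccontr)
    assume "\<not> ord y \<le> ord x"
    then have "ord x < min (ord y) (ord (y - x))" using assms by simp
    also have "\<dots> \<le> ord (y - (y - x))"
      using ord_diff_ge[of "min (ord y) (ord (y - x))" y "y - x"] by simp
    finally show False by simp
  qed
qed

lemma ord_mult_ge:
  "ereal B \<le> ord x \<Longrightarrow> ereal C \<le> ord y \<Longrightarrow> ereal (B + C) \<le> ord (x * y)"
  unfolding ord_mult plus_ereal.simps(1)[symmetric] by (rule add_mono)

lemma ord_sum_ge: "(\<And>i. i \<in> I \<Longrightarrow> B \<le> ord (f i)) \<Longrightarrow> B \<le> ord (sum f I)"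
  by (induction I rule: infinite_finite_induct) (auto intro: ord_add_ge)

lemma ord_prod_ge:
  "(\<And>i. i \<in> I \<Longrightarrow> ereal (c i) \<le> ord (f i)) \<Longrightarrow> ereal (sum c I) \<le> ord (prod f I)"
  by (induction I rule: infinite_finite_induct) (auto intro: ord_mult_ge simp flip: zero_ereal_def)

text \<open>Each Leibniz term takes exactly one entry from every row, so bounds by rows add
  up.\<close>

lemma ord_det_ge:
  assumes "\<And>i j. i < n \<Longrightarrow> j < n \<Longrightarrow> ereal (c i) \<le> ord (f i j)"
  shows "ereal (\<Sum>i<n. c i) \<le> ord (det (mat n n (\<lambda>(i, j). f i j)))"
proof -
  have "ereal (\<Sum>i = 0..<n. c i) \<le> ord (\<Prod>i = 0..<n. f i (\<pi> i))" if "\<pi> permutes {0..<n}" for \<pi>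
    using assms permutes_in_image[OF that] by (intro ord_prod_ge) auto
  then show ?thesis
    unfolding det_mat_expand lessThan_atLeast0 by (intro ord_sum_ge) simp
qed

text \<open>The factors are exchanged one at a time. Each of the resulting terms contains one
  difference and \<open>card I - 1\<close> other factors; \<open>c \<le> 0\<close> allows counting
  \<open>card I\<close> of them.\<close>

lemma ord_prod_diff_ge:
  assumes "finite I" "c \<le> 0"
    and "\<And>i. i \<in> I \<Longrightarrow> ereal c \<le> ord (f i)" "\<And>i. i \<in> I \<Longrightarrow> ereal c \<le> ord (f' i)"
    and "\<And>i. i \<in> I \<Longrightarrow> ereal B \<le> ord (f i - f' i)"
  shows "ereal (B + real (card I) * c) \<le> ord (prod f I - prod f' I)"
  using assms(1,3-)
proof (induction I rule: finite_induct)
  case (insert x I)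
  have eq: "prod f (insert x I) - prod f' (insert x I) =
      f x * (prod f I - prod f' I) + (f x - f' x) * prod f' I"
    using insert by (simp add: algebra_simps)
  have "ereal (c + (B + real (card I) * c)) \<le> ord (f x * (prod f I - prod f' I))"
    using insert by (intro ord_mult_ge) auto
  moreover have "ereal (B + (\<Sum>i\<in>I. c)) \<le> ord ((f x - f' x) * prod f' I)"
    using insert by (intro ord_mult_ge ord_prod_ge) auto
  then have "ereal (B + real (card I) * c) \<le> ord ((f x - f' x) * prod f' I)" by simp
  then have "ereal (c + (B + real (card I) * c)) \<le> ord ((f x - f' x) * prod f' I)"
    using assms(2) by (auto elim!: order_trans[rotated])
  ultimately show ?case
    unfolding eq using insert by (intro ord_add_ge) (auto simp: algebra_simps)
qed simp

lemma ord_det_diff_ge: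
  assumes "c \<le> 0"
    and "\<And>i j. i < n \<Longrightarrow> j < n \<Longrightarrow> ereal c \<le> ord (f i j)"
    and "\<And>i j. i < n \<Longrightarrow> j < n \<Longrightarrow> ereal c \<le> ord (f' i j)"
    and "\<And>i j. i < n \<Longrightarrow> j < n \<Longrightarrow> ereal B \<le> ord (f i j - f' i j)"
  shows "ereal (B + real n * c) \<le>
    ord (det (mat n n (\<lambda>(i, j). f i j)) - det (mat n n (\<lambda>(i, j). f' i j)))"
proof -
  have "ereal (B + real (card {0..<n}) * c) \<le>
      ord ((\<Prod>i = 0..<n. f i (\<pi> i)) - (\<Prod>i = 0..<n. f' i (\<pi> i)))" if "\<pi> permutes {0..<n}" for \<pi>
    using assms permutes_in_image[OF that] by (intro ord_prod_diff_ge) auto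
  then show ?thesis
    unfolding det_mat_expand sum_subtractf[symmetric] right_diff_distrib[symmetric]
    by (auto intro!: ord_sum_ge)
qed

section \<open>Convergence and infinite sums in terms of the valuation\<close>

lemma p_gt_1: "real p > 1"
  using prime_p prime_gt_1_nat by auto

lemma dist_less_iff: "dist x y < real p powr (- B) \<longleftrightarrow> ereal B < ord (x - y)"
proof (cases "x = y")
  case False
  obtain v where v: "ord (x - y) = ereal v" using ord_real[of "x - y"] False by auto
  show ?thesis using p_gt_1 dist_ord[OF False] v by simp
qed (use p_gt_1 in auto)

lemma ex_powr_less: "e > 0 \<Longrightarrow> \<exists>n::nat. real p powr (- real n) < e"
proof -
  assume e: "e > 0"
  obtain n where "- log p e < real n" using reals_Archimedean2 by blast
  then show ?thesis using e p_gt_1 by (intro exI[of _ n]) (simp add: powr_less_iff)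
qed

lemma LIMSEQ_iff_ord:
  "X \<longlonglongrightarrow> x \<longleftrightarrow> (\<forall>B. \<forall>\<^sub>F n in sequentially. ereal B < ord (X n - x))"
proof
  assume X: "X \<longlonglongrightarrow> x"
  show "\<forall>B. \<forall>\<^sub>F n in sequentially. ereal B < ord (X n - x)"
  proof
    fix B
    show "\<forall>\<^sub>F n in sequentially. ereal B < ord (X n - x)"
      using tendstoD[OF X, of "real p powr (- B)"] p_gt_1 by (simp add: dist_less_iff)
  qed
next
  assume X: "\<forall>B. \<forall>\<^sub>F n in sequentially. ereal B < ord (X n - x)"
  show "X \<longlonglongrightarrow> x"
  proof (rule tendstoI)
    fix e :: real assume "e > 0"
    then obtain n where "real p powr (- real n) < e" using ex_powr_less by blast
    then show "\<forall>\<^sub>F n in sequentially. dist (X n) x < e"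
      using X[rule_format, of n] by (auto elim!: eventually_mono simp flip: dist_less_iff)
  qed
qed

text \<open>The premise \<open>fin\<close> says that the terms tend to 0. The sums over the finite
  sets \<open>G n\<close> of terms of valuation below \<open>n\<close> are then Cauchy, and
  completeness provides a limit. It is the unconditional sum, because terms outside
  \<open>G n\<close> change a partial sum only by valuation at least \<open>n\<close>.\<close>

lemma infsum_approx:
  assumes fin: "\<And>B. finite {i \<in> A. ord (f i) < ereal B}"
    and F: "finite F" "F \<subseteq> A" and F_ge: "\<And>i. i \<in> A - F \<Longrightarrow> ereal B \<le> ord (f i)"
  shows "ereal B \<le> ord (infsum f A - sum f F)"
proof -
  define G where "G n = {i \<in> A. ord (f i) < ereal (real n)}" for n
  define X where "X n = sum f (G n)" for n
  have G: "finite (G n)" "G n \<subseteq> A" for n using fin by (auto simp: G_def)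
  have diff: "ereal B' \<le> ord (sum f H - sum f H')"
    if "finite H" "H' \<subseteq> H" "\<And>i. i \<in> H - H' \<Longrightarrow> ereal B' \<le> ord (f i)" for B' H H'
    using that by (subst sum_diff[symmetric]) (auto intro: ord_sum_ge)
  have X_diff: "ereal (real n) \<le> ord (X m - X n)" if "n \<le> m" for m n
    unfolding X_def
  proof (rule diff)
    show "G n \<subseteq> G m" using that by (auto simp: G_def intro: less_le_trans)
  qed (use G in \<open>auto simp: G_def not_less\<close>)
  have "Cauchy X"
  proof (rule metric_CauchyI)
    fix e :: real assume "e > 0"
    then obtain n where n: "real p powr (- real n) < e" using ex_powr_less by blast
    \<comment> \<open>\<open>Suc n\<close> in place of \<open>n\<close> turns the weak bound of
      \<open>X_diff\<close> into a strict one.\<close>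
    have "dist (X m) (X m') < e" if "m \<ge> Suc n" "m' \<ge> Suc n" for m m'
    proof -
      have "ereal (real (Suc n)) \<le> ord (X m - X m')"
        using ord_diff_trans[OF X_diff[OF that(1)]] X_diff[OF that(2)] by (simp add: ord_minus_commute)
      then have "ereal (real n) < ord (X m - X m')" by (auto intro: less_le_trans[rotated])
      then show ?thesis using n by (auto simp flip: dist_less_iff)
    qed
    then show "\<exists>M. \<forall>m\<ge>M. \<forall>n\<ge>M. dist (X m) (X n) < e" by blast
  qed
  then obtain x where x: "X \<longlonglongrightarrow> x"
    using Cauchy_convergent convergent_def by blast
  have x_diff: "ereal (real n) \<le> ord (x - X n)" for n
  proof -
    have "\<forall>\<^sub>F m in sequentially. n \<le> m \<and> ereal (real n) < ord (X m - x)"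
      using x by (simp add: LIMSEQ_iff_ord eventually_conj eventually_ge_at_top)
    then obtain m where "m \<ge> n" "ereal (real n) < ord (X m - x)"
      by (auto simp: eventually_sequentially)
    then have "ereal (real n) \<le> ord (x - X m)" by (simp add: ord_minus_commute)
    then show ?thesis using X_diff[OF \<open>n \<le> m\<close>] by (rule ord_diff_trans)
  qed
  have H_diff: "ereal (real n) \<le> ord (sum f H - x)" if "finite H" "G n \<subseteq> H" "H \<subseteq> A" for H n
  proof -
    have "ereal (real n) \<le> ord (sum f H - X n)"
      unfolding X_def using that by (intro diff) (auto simp: G_def)
    moreover have "ereal (real n) \<le> ord (X n - x)"
      using x_diff by (simp add: ord_minus_commute)
    ultimately show ?thesis by (rule ord_diff_trans)
  qed
  have "(f has_sum x) A"
    unfolding has_sum_def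
  proof (rule tendstoI)
    fix e :: real assume "e > 0"
    then obtain n where n: "real p powr (- real n) < e" using ex_powr_less by blast
    have "dist (sum f H) x < e" if "finite H" "G (Suc n) \<subseteq> H" "H \<subseteq> A" for H
    proof -
      have "ereal (real n) < ord (sum f H - x)"
        using H_diff[OF that] by (auto intro: less_le_trans[rotated])
      then show ?thesis using n by (auto simp flip: dist_less_iff)
    qed
    then show "\<forall>\<^sub>F H in finite_subsets_at_top A. dist (sum f H) x < e"
      unfolding eventually_finite_subsets_at_top using G by (intro exI[of _ "G (Suc n)"]) auto
  qed
  then have sum_eq: "infsum f A = x" by (rule infsumI)
  \<comment> \<open>\<open>F\<close> and \<open>G n\<close> need not be nested, so the comparison
    passes through their union.\<close>
  obtain n where n: "B \<le> real n" using real_arch_simple by blast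
  have "ereal B \<le> ereal (real n)" using n by simp
  also have "\<dots> \<le> ord (sum f (G n \<union> F) - x)"
    using G F by (intro H_diff) auto
  finally have "ereal B \<le> ord (x - sum f (G n \<union> F))" by (simp add: ord_minus_commute)
  moreover have "ereal B \<le> ord (sum f (G n \<union> F) - sum f F)"
    using G(1)[of n] G(2)[of n] F by (intro diff F_ge) auto
  ultimately show ?thesis unfolding sum_eq by (rule ord_diff_trans)
qed

lemma ord_ge_real: "\<exists>c\<le>0. ereal c \<le> ord x"
proof (cases "ord x")
  case (real r)
  then show ?thesis by (intro exI[of _ "min 0 r"]) auto
qed (use ord_not_MInfty[of x] in auto)

text \<open>The sort of \<open>'k\<close> does not link the metric to the field operations; their
  continuity comes from the valuation.\<close>

lemma tendsto_add_ord:
  fixes x y :: 'k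
  assumes "X \<longlonglongrightarrow> x" "Y \<longlonglongrightarrow> y"
  shows "(\<lambda>n. X n + Y n) \<longlonglongrightarrow> x + y"
  unfolding LIMSEQ_iff_ord
proof
  fix B
  have "\<forall>\<^sub>F n in sequentially. ereal B < ord (X n - x) \<and> ereal B < ord (Y n - y)"
    using assms by (simp add: LIMSEQ_iff_ord eventually_conj)
  then show "\<forall>\<^sub>F n in sequentially. ereal B < ord (X n + Y n - (x + y))"
  proof eventually_elim
    case (elim n)
    then show ?case
      using less_le_trans[OF _ ord_add[of "X n - x" "Y n - y"], of "ereal B"]
      by (simp add: algebra_simps)
  qed
qed

lemma tendsto_mult_ord:
  fixes x y :: 'k
  assumes "X \<longlonglongrightarrow> x" "Y \<longlonglongrightarrow> y"
  shows "(\<lambda>n. X n * Y n) \<longlonglongrightarrow> x * y"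
  unfolding LIMSEQ_iff_ord
proof
  fix B
  obtain c c' where c: "c \<le> 0" "ereal c \<le> ord x" and c': "c' \<le> 0" "ereal c' \<le> ord y"
    using ord_ge_real by meson
  \<comment> \<open>\<open>c\<close> keeps \<open>X n\<close> itself at valuation at least
    \<open>c\<close>. The other bound offsets the losses from the factors \<open>X n\<close> and
    \<open>y\<close> in the splitting \<open>X n * (Y n - y) + (X n - x) * y\<close>, and its
    summand 1 gives strictness.\<close>
  define B' where "B' = max c (B + 1 - c - c')"
  have "\<forall>\<^sub>F n in sequentially. ereal B' < ord (X n - x) \<and> ereal B' < ord (Y n - y)"
    using assms by (simp add: LIMSEQ_iff_ord eventually_conj)
  then show "\<forall>\<^sub>F n in sequentially. ereal B < ord (X n * Y n - x * y)"
  proof eventually_elim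
    case (elim n)
    have "ereal (B + 1 - c - c') \<le> ereal B'" "ereal c \<le> ereal B'"
      by (auto simp: B'_def)
    then have ge: "ereal (B + 1 - c - c') \<le> ord (X n - x)"
      "ereal (B + 1 - c - c') \<le> ord (Y n - y)" "ereal c \<le> ord (X n - x)"
      using elim less_imp_le order_trans by meson+
    have "ereal c \<le> ord (X n)"
      using ord_add_ge[OF ge(3) c(2)] by simp
    then have "ereal (c + (B + 1 - c - c')) \<le> ord (X n * (Y n - y))"
      using ge by (intro ord_mult_ge) auto
    then have "ereal (B + 1) \<le> ord (X n * (Y n - y))"
      using c' by (auto elim!: order_trans[rotated])
    moreover have "ereal ((B + 1 - c - c') + c') \<le> ord ((X n - x) * y)"
      using ge c' by (intro ord_mult_ge) auto
    then have "ereal (B + 1) \<le> ord ((X n - x) * y)"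
      using c by (auto elim!: order_trans[rotated])
    ultimately have "ereal (B + 1) \<le> ord (X n * (Y n - y) + (X n - x) * y)"
      by (rule ord_add_ge)
    also have "X n * (Y n - y) + (X n - x) * y = X n * Y n - x * y"
      by (simp add: algebra_simps)
    finally show ?case by (auto intro: less_le_trans[rotated])
  qed
qed

end


section \<open>The action of the Galois group\<close>

context padic_complex_numbers
begin

section \<open>Field operations on \<open>Qp_bar\<close>\<close>

lemma Rats_subset_Qp: "\<rat> \<subseteq> (Qp :: 'k set)"
  unfolding Qp_def by (rule closure_subset)

lemma Qp_add: "x \<in> Qp \<Longrightarrow> y \<in> Qp \<Longrightarrow> x + y \<in> (Qp :: 'k set)"
proof -
  assume "x \<in> Qp" "y \<in> Qp"
  then obtain X Y where "\<And>n. X n \<in> \<rat>" "X \<longlonglongrightarrow> x" "\<And>n. Y n \<in> \<rat>" "Y \<longlonglongrightarrow> y"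
    unfolding Qp_def closure_sequential by metis
  then have "(\<lambda>n. X n + Y n) \<longlonglongrightarrow> x + y" "\<And>n. X n + Y n \<in> \<rat>"
    by (auto intro: tendsto_add_ord)
  then show ?thesis
    unfolding Qp_def closure_sequential by (intro exI[of _ "\<lambda>n. X n + Y n"]) auto
qed

lemma Qp_mult: "x \<in> Qp \<Longrightarrow> y \<in> Qp \<Longrightarrow> x * y \<in> (Qp :: 'k set)"
proof -
  assume "x \<in> Qp" "y \<in> Qp"
  then obtain X Y where "\<And>n. X n \<in> \<rat>" "X \<longlonglongrightarrow> x" "\<And>n. Y n \<in> \<rat>" "Y \<longlonglongrightarrow> y"
    unfolding Qp_def closure_sequential by metis
  then have "(\<lambda>n. X n * Y n) \<longlonglongrightarrow> x * y" "\<And>n. X n * Y n \<in> \<rat>"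
    by (auto intro: tendsto_mult_ord)
  then show ?thesis
    unfolding Qp_def closure_sequential by (intro exI[of _ "\<lambda>n. X n * Y n"]) auto
qed

lemma Qp_subset_Qp_bar: "Qp \<subseteq> (Qp_bar :: 'k set)"
proof
  fix x :: 'k assume x: "x \<in> Qp"
  have "- 1 \<in> (Qp :: 'k set)" "0 \<in> (Qp :: 'k set)" "1 \<in> (Qp :: 'k set)" using Rats_subset_Qp by auto
  then have "coeff [:- x, 1:] i \<in> Qp" for i
    using Qp_mult[OF _ x, of "- 1"] by (auto simp: coeff_pCons split: nat.split)
  then show "x \<in> Qp_bar"
    unfolding Qp_bar_def by (intro CollectI exI[of _ "[:- x, 1:]"]) auto
qed

lemma Rats_subset_Qp_bar: "\<rat> \<subseteq> (Qp_bar :: 'k set)"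
  using Rats_subset_Qp Qp_subset_Qp_bar by blast

text \<open>Algebraic closedness, applied to linear polynomials, makes \<open>Qp_bar\<close> closed under division.\<close>

lemma Qp_bar_linear_root:
  assumes "x \<in> Qp_bar" "y \<in> Qp_bar" "y \<noteq> 0"
  shows "- x / y \<in> (Qp_bar :: 'k set)"
proof -
  have "0 \<in> (Qp_bar :: 'k set)" using Rats_subset_Qp_bar by auto
  then have "coeff [:x, y:] i \<in> Qp_bar" for i
    using assms by (auto simp: coeff_pCons split: nat.split)
  then obtain z where "z \<in> Qp_bar" "poly [:x, y:] z = 0"
    using Qp_bar_alg_closed[of "[:x, y:]"] assms by auto
  moreover from this have "z = - x / y"
    using assms by (simp add: field_simps add_eq_0_iff)
  ultimately show ?thesis by simp
qed

lemma Qp_bar_uminus: "x \<in> Qp_bar \<Longrightarrow> - x \<in> (Qp_bar :: 'k set)"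
  using Qp_bar_linear_root[of x 1] Rats_subset_Qp_bar by auto

lemma Qp_bar_inverse: "x \<in> Qp_bar \<Longrightarrow> inverse x \<in> (Qp_bar :: 'k set)"
  using Qp_bar_linear_root[of "- 1" x] subsetD[OF Rats_subset_Qp_bar, of "- 1"]
  by (cases "x = 0") (auto simp: field_simps)

text \<open>For \<open>y \<noteq> 0\<close> the product is the quotient of \<open>x\<close> by
  \<open>inverse y\<close>, again a root of a linear polynomial.\<close>

lemma Qp_bar_mult: "x \<in> Qp_bar \<Longrightarrow> y \<in> Qp_bar \<Longrightarrow> x * y \<in> (Qp_bar :: 'k set)"
  using Qp_bar_linear_root[of "- x" "inverse y"] Qp_bar_uminus[of x] Qp_bar_inverse[of y]
  by (cases "y = 0") (auto simp: field_simps)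

lemma coeff_mult_mem_Qp:
  assumes "\<And>i. coeff q i \<in> (Qp :: 'k set)" "\<And>i. coeff r i \<in> Qp"
  shows "coeff (q * r) i \<in> Qp"
proof -
  have sum: "sum f {..n} \<in> Qp" if "\<And>j. f j \<in> Qp" for f :: "nat \<Rightarrow> 'k" and n
    using that by (induction n) (auto intro: Qp_add)
  show ?thesis unfolding coeff_mult by (intro sum Qp_mult assms)
qed

text \<open>Substituting \<open>X - 1\<close> into a polynomial that kills \<open>x\<close> gives
  one that kills \<open>x + 1\<close>, still with coefficients in \<open>Qp\<close>.\<close>

lemma Qp_bar_add_1:
  assumes "x \<in> Qp_bar"
  shows "x + 1 \<in> (Qp_bar :: 'k set)"
proof -
  obtain f where f: "f \<noteq> 0" "\<And>i. coeff f i \<in> (Qp :: 'k set)" "poly f x = 0"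
    using assms by (auto simp: Qp_bar_def)
  have Rats: "- 1 \<in> (Qp :: 'k set)" "0 \<in> (Qp :: 'k set)" "1 \<in> (Qp :: 'k set)"
    using Rats_subset_Qp by auto
  have "coeff (pcompose q [:- 1, 1:]) i \<in> Qp" if "\<And>i. coeff q i \<in> Qp" for q :: "'k poly" and i
    using that
  proof (induction q arbitrary: i)
    case (pCons a q)
    have a: "a \<in> Qp" using pCons.prems[of 0] by simp
    have q: "coeff q i \<in> Qp" for i using pCons.prems[of "Suc i"] by simp
    have "coeff ([:- 1, 1:] * pcompose q [:- 1, 1:]) i \<in> Qp"
      using pCons.IH[OF q] Rats
      by (intro coeff_mult_mem_Qp) (auto simp: coeff_pCons split: nat.split)
    moreover have "coeff [:a:] i \<in> Qp" using a Rats by (auto simp: coeff_pCons split: nat.split)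
    ultimately show ?case
      unfolding pcompose_pCons coeff_add by (rule Qp_add[rotated])
  qed (use Rats in auto)
  moreover have "pcompose f [:- 1, 1:] \<noteq> 0"
    using f(1) by (simp add: pcompose_eq_0_iff)
  moreover have "poly (pcompose f [:- 1, 1:]) (x + 1) = 0"
    using f(3) by (simp add: poly_pcompose)
  ultimately show ?thesis unfolding Qp_bar_def using f(2) by blast
qed

text \<open>Writing \<open>x + y\<close> as \<open>x * (y / x + 1)\<close> reduces addition to
  multiplication and the successor.\<close>

lemma Qp_bar_add:
  assumes "x \<in> Qp_bar" "y \<in> Qp_bar"
  shows "x + y \<in> (Qp_bar :: 'k set)"
proof (cases "x = 0")
  case False
  have "x * (y * inverse x + 1) \<in> Qp_bar"
    using assms by (intro Qp_bar_mult Qp_bar_add_1 Qp_bar_inverse)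
  moreover have "x * (y * inverse x + 1) = x + y" using False by (simp add: field_simps)
  ultimately show ?thesis by simp
qed (use assms in auto)

lemma ord_p_power_int: "ord (of_nat p powi m) = ereal (of_int m)"
proof -
  have "of_nat p \<noteq> (0 :: 'k)" using p_gt_1 by auto
  then show ?thesis
    by (auto simp: power_int_def ord_power ord_inverse ord_p power_inverse[symmetric])
qed

end

locale Cp_action = padic_complex_numbers p ord
  for p :: nat and ord :: "'k :: {field_char_0, complete_space} \<Rightarrow> ereal" +
  fixes \<sigma> g :: "'k \<Rightarrow> 'k"
  assumes galois: "galois_Qp \<sigma>" and action: "is_Cp_action \<sigma> g"
begin

section \<open>The continuous extension is a ring homomorphism and preserves the valuation\<close>

lemma tendsto_g: "X \<longlonglongrightarrow> x \<Longrightarrow> (\<lambda>n. g (X n)) \<longlonglongrightarrow> g x"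
  using action unfolding is_Cp_action_def
  by (auto intro!: isCont_tendsto_compose[of x g] simp: continuous_on_eq_continuous_at)

lemma Qp_bar_lim:
  obtains X where "\<And>n. X n \<in> Qp_bar" "X \<longlonglongrightarrow> x" "(\<lambda>n. g (X n)) \<longlonglongrightarrow> g x"
proof -
  have "x \<in> closure Qp_bar" using Qp_bar_dense by simp
  then obtain X where "\<And>n. X n \<in> Qp_bar" "X \<longlonglongrightarrow> x"
    unfolding closure_sequential by blast
  then show ?thesis using that[of X] tendsto_g by simp
qed

lemma g_add_bar: "x \<in> Qp_bar \<Longrightarrow> y \<in> Qp_bar \<Longrightarrow> g (x + y) = g x + g y"
  using galois action Qp_bar_add by (auto simp: galois_Qp_def is_Cp_action_def)

lemma g_mult_bar: "x \<in> Qp_bar \<Longrightarrow> y \<in> Qp_bar \<Longrightarrow> g (x * y) = g x * g y"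
  using galois action Qp_bar_mult by (auto simp: galois_Qp_def is_Cp_action_def)

lemma g_Rats: "x \<in> \<rat> \<Longrightarrow> g x = x"
  using galois action Rats_subset_Qp Qp_subset_Qp_bar
  by (auto simp: galois_Qp_def is_Cp_action_def subset_eq)

lemma g_0 [simp]: "g 0 = 0" and g_1 [simp]: "g 1 = 1"
  by (auto intro: g_Rats)

text \<open>Both identities hold on the dense set \<open>Qp_bar\<close> and survive passage to the
  limit.\<close>

sublocale g: comm_ring_hom g
proof
  fix x y
  obtain X where X: "\<And>n. X n \<in> Qp_bar" "X \<longlonglongrightarrow> x" "(\<lambda>n. g (X n)) \<longlonglongrightarrow> g x"
    using Qp_bar_lim by blast
  obtain Y where Y: "\<And>n. Y n \<in> Qp_bar" "Y \<longlonglongrightarrow> y" "(\<lambda>n. g (Y n)) \<longlonglongrightarrow> g y"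
    using Qp_bar_lim by blast
  show "g (x + y) = g x + g y"
    using tendsto_g[OF tendsto_add_ord[OF X(2) Y(2)]] tendsto_add_ord[OF X(3) Y(3)]
    unfolding g_add_bar[OF X(1) Y(1)] by (rule LIMSEQ_unique)
  show "g (x * y) = g x * g y"
    using tendsto_g[OF tendsto_mult_ord[OF X(2) Y(2)]] tendsto_mult_ord[OF X(3) Y(3)]
    unfolding g_mult_bar[OF X(1) Y(1)] by (rule LIMSEQ_unique)
qed auto

text \<open>If \<open>ord x > 0\<close>, then \<open>x ^ n\<close> tends to \<open>0\<close>, hence so does \<open>g x ^ n\<close> by continuity. This
  replaces the uniqueness of the extension of the valuation from \<open>Qp\<close> to \<open>Qp_bar\<close>.\<close>

lemma ord_g_pos:
  assumes "ord x > 0"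
  shows "ord (g x) > 0"
proof (cases "x = 0")
  case False
  then obtain v where "ord x = ereal v" using ord_real by blast
  then have v: "ord x = ereal v" "v > 0" using assms by auto
  have "(\<lambda>n. x ^ n) \<longlonglongrightarrow> 0"
    unfolding LIMSEQ_iff_ord
  proof
    fix B
    obtain n where "B / v < real n" using reals_Archimedean2 by blast
    then have "ereal B < ord (x ^ m - 0)" if "m \<ge> n" for m
      using that v by (auto simp: ord_power field_simps
          intro: less_le_trans[of B "v * real n"])
    then show "\<forall>\<^sub>F n in sequentially. ereal B < ord (x ^ n - 0)"
      by (auto simp: eventually_sequentially)
  qed
  then have "(\<lambda>n. g x ^ n) \<longlonglongrightarrow> 0"
    using tendsto_g g.hom_power by fastforce
  then obtain n where "ereal 0 < ord (g x ^ n)"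
    by (auto simp: LIMSEQ_iff_ord eventually_sequentially)
  then show ?thesis
    using ord_not_MInfty[of "g x"] by (cases "ord (g x)") (auto simp: ord_power zero_less_mult_iff)
qed (use assms in auto)

text \<open>If \<open>g\<close> lowered the valuation of \<open>x\<close>, then a power of
  \<open>x\<close> times a power of \<open>p\<close> would have positive valuation while its image
  has negative valuation, contrary to \<open>ord_g_pos\<close>.\<close>

lemma ord_g_ge:
  assumes "x \<noteq> 0"
  shows "ord x \<le> ord (g x)"
proof (rule ccontr)
  assume "\<not> ord x \<le> ord (g x)"
  moreover have "ord (g x) \<noteq> - \<infinity>" by (rule ord_not_MInfty)
  moreover obtain v where v: "ord x = ereal v" using ord_real assms by blast
  ultimately obtain w where w: "ord (g x) = ereal w" "w < v"
    by (cases "ord (g x)") auto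
  obtain r where r: "r \<in> \<rat>" "w < r" "r < v" using Rats_dense_in_real[OF w(2)] by blast
  then obtain m n where mn: "n > 0" "r = of_int m / of_int n" by (elim Rats_cases')
  \<comment> \<open>\<open>z\<close> is rational, hence fixed by \<open>g\<close>. Its valuation
    \<open>- m\<close> shifts \<open>n * v\<close> above 0 and \<open>n * w\<close> below 0.\<close>
  define z where "z = (of_nat p :: 'k) powi (- m)"
  have z: "ord z = ereal (- of_int m)" "g z = z"
    unfolding z_def by (subst ord_p_power_int, simp) (auto intro: g_Rats simp: power_int_def)
  have "real_of_int m < v * real_of_int n" "w * real_of_int n < real_of_int m"
    using r mn by (simp_all add: field_simps)
  then have nm: "real_of_int m < v * real (nat n)" "w * real (nat n) < real_of_int m"
    using mn by simp_all
  have "ord (x ^ nat n * z) > 0"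
    using nm mn(1) by (simp add: ord_mult ord_power v z algebra_simps)
  then have "ord (g (x ^ nat n * z)) > 0" by (rule ord_g_pos)
  then show False
    using nm mn(1) by (simp add: ord_mult ord_power w z g.hom_mult g.hom_power algebra_simps)
qed

text \<open>Applying \<open>ord_g_ge\<close> to \<open>inverse x\<close> reverses the
  inequality.\<close>

lemma ord_g [simp]: "ord (g x) = ord x"
proof (cases "x = 0")
  case False
  have "g x * g (inverse x) = 1"
    using False by (simp flip: g.hom_mult)
  then have "g x \<noteq> 0" and inv: "g (inverse x) = inverse (g x)"
    by (auto simp: inverse_unique)
  have "- ord x \<le> - ord (g x)"
    using ord_g_ge[of "inverse x"] False \<open>g x \<noteq> 0\<close> by (simp add: inv ord_inverse)
  then show ?thesis using ord_g_ge[OF False] by (simp add: antisym)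
qed simp

lemma comm_ring_hom_funpow_g: "comm_ring_hom (g ^^ n)"
proof
  show "(g ^^ n) (x + y) = (g ^^ n) x + (g ^^ n) y" for x y
    by (induction n) (auto simp: g.hom_add)
  show "(g ^^ n) (x * y) = (g ^^ n) x * (g ^^ n) y" for x y
    by (induction n) (auto simp: g.hom_mult)
  show "(g ^^ n) 0 = 0" "(g ^^ n) 1 = 1"
    by (induction n) auto
qed

lemma ord_funpow_g [simp]: "ord ((g ^^ n) x) = ord x"
  by (induction n) auto

end


section \<open>Minors of the twisted product\<close>

text \<open>Only the summation indices are confined to \<open>V\<close>. For finite \<open>V\<close>
  every stage is a finite sum, to which Cauchy--Binet applies.\<close>

primrec truncated_product ::
    "('k :: comm_ring_1 \<Rightarrow> 'k) \<Rightarrow> 'k inf_matrix \<Rightarrow> nat set \<Rightarrow> nat \<Rightarrow> 'k inf_matrix"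
  where
    "truncated_product g M V 0 = M"
  | "truncated_product g M V (Suc n) =
       (\<lambda>i j. \<Sum>l\<in>V. (g ^^ Suc n) (M i l) * truncated_product g M V n l j)"

text \<open>For \<open>card T = card S\<close> these are the entries of a compound matrix. The size
  is read off from \<open>S\<close> alone.\<close>

definition minor :: "'k :: comm_ring_1 inf_matrix \<Rightarrow> nat set \<Rightarrow> nat set \<Rightarrow> 'k"
  where "minor A S T = det (mat (card S) (card S)
    (\<lambda>(i, j). A (sorted_list_of_set S ! i) (sorted_list_of_set T ! j)))"

definition index_sets :: "nat \<Rightarrow> nat set set"
  where "index_sets k = {S. S \<subseteq> {1..} \<and> finite S \<and> card S = k}"

lemma index_setsD: "S \<in> index_sets k \<Longrightarrow> S \<subseteq> {1..} \<and> finite S \<and> card S = k"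
  by (simp add: index_sets_def)

lemma sorted_list_of_index_set:
  assumes "S \<in> index_sets k" "i < k"
  shows "sorted_list_of_set S ! i \<in> S" "sorted_list_of_set S ! i \<ge> 1"
proof -
  show "sorted_list_of_set S ! i \<in> S"
    using assms nth_mem[of i "sorted_list_of_set S"] by (simp add: index_sets_def)
  then show "sorted_list_of_set S ! i \<ge> 1" using assms by (auto simp: index_sets_def)
qed

lemma det_principal_submatrix: "det (principal_submatrix A S) = minor A S S"
  by (simp add: principal_submatrix_def minor_def)

lemma det_leading_submatrix: "det (leading_submatrix A k) = minor A {1..k} {1..k}"
proof -
  have "sorted_list_of_set {1..k} = [1..<Suc k]"
    by (metis atLeastLessThanSuc_atLeastAtMost sorted_list_of_set_range)
  then show ?thesis
    unfolding leading_submatrix_def minor_def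
    by (intro arg_cong[of _ _ det] eq_matI) (auto simp del: upt_Suc)
qed

text \<open>Cauchy--Binet, read as multiplicativity of compound matrices.\<close>

lemma minor_mult:
  assumes "finite V"
  shows "minor (\<lambda>i j. \<Sum>l\<in>V. A i l * B l j) S T =
    (\<Sum>U | U \<subseteq> V \<and> card U = card S. minor A S U * minor B U T)"
  unfolding minor_def det_mat_sum_mult[OF assms] by (auto intro!: sum.cong)

lemma (in comm_ring_hom) minor_hom: "minor (\<lambda>i j. hom (A i j)) S T = hom (minor A S T)"
  unfolding minor_def hom_det[symmetric] by (rule arg_cong[of _ _ det], rule eq_matI) auto

text \<open>\<open>S - {1..k}\<close> and \<open>{1..k} - S\<close> have the same positive size.
  Exchanging one index of the latter, at most \<open>k\<close>, for one of the former, at least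
  \<open>k + 1\<close>, gains at least \<open>h (k + 1) - h k\<close>.\<close>

lemma sum_initial_segment_le:
  fixes h :: "nat \<Rightarrow> real"
  assumes h: "mono_on {1..} h" and S: "S \<in> index_sets k" "S \<noteq> {1..k}" and k: "k \<ge> 1"
  shows "(\<Sum>i = 1..k. h i) + (h (k + 1) - h k) \<le> (\<Sum>i\<in>S. h i)"
proof -
  let ?K = "{1..k}"
  note S' = index_setsD[OF S(1)]
  have card: "card (S - ?K) = card (?K - S)"
    using card_Diff_subset_Int[of S ?K] card_Diff_subset_Int[of ?K S] S' by (simp add: Int_commute)
  have "S - ?K \<noteq> {}"
    using S' S(2) card_subset_eq[of ?K S] by auto
  then have pos: "1 \<le> card (S - ?K)" using S' by (simp add: Suc_le_eq card_gt_0_iff)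
  have "(\<Sum>i\<in>S. h i) - (\<Sum>i\<in>?K. h i) = (\<Sum>i\<in>S - ?K. h i) - (\<Sum>i\<in>?K - S. h i)"
    using sum.Int_Diff[of S h ?K] sum.Int_Diff[of ?K h S] S' by (simp add: Int_commute)
  moreover have "real (card (S - ?K)) * h (k + 1) \<le> (\<Sum>i\<in>S - ?K. h i)"
    using S' by (intro sum_bounded_below monotone_onD[OF h]) auto
  moreover have "(\<Sum>i\<in>?K - S. h i) \<le> real (card (?K - S)) * h k"
    using k by (intro sum_bounded_above monotone_onD[OF h]) auto
  moreover have "1 * (h (k + 1) - h k) \<le> real (card (S - ?K)) * (h (k + 1) - h k)"
    using pos k by (intro mult_right_mono) (auto intro!: monotone_onD[OF h])
  ultimately show ?thesis unfolding card by (simp add: algebra_simps)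
qed

context padic_complex_numbers
begin

lemma ord_minor_ge:
  assumes "S \<in> index_sets k" "T \<in> index_sets k"
    and "\<And>i j. i \<in> S \<Longrightarrow> 1 \<le> j \<Longrightarrow> ereal (c i) \<le> ord (A i j)"
  shows "ereal (\<Sum>i\<in>S. c i) \<le> ord (minor A S T)"
proof -
  have "finite S" "card S = k" using assms by (auto simp: index_sets_def)
  then have "bij_betw ((!) (sorted_list_of_set S)) {..<k} S"
    by (intro bij_betw_nth) auto
  then have "(\<Sum>i\<in>S. c i) = (\<Sum>i<k. c (sorted_list_of_set S ! i))"
    by (rule sum.reindex_bij_betw[symmetric])
  also have "ereal \<dots> \<le> ord (minor A S T)"
    unfolding minor_def \<open>card S = k\<close>
    using assms sorted_list_of_index_set by (intro ord_det_ge) auto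
  finally show ?thesis .
qed

lemma ord_minor_diff_ge:
  assumes "S \<in> index_sets k" "T \<in> index_sets k" "c \<le> 0"
    and "\<And>i j. 1 \<le> i \<Longrightarrow> 1 \<le> j \<Longrightarrow> ereal c \<le> ord (A i j)"
    and "\<And>i j. 1 \<le> i \<Longrightarrow> 1 \<le> j \<Longrightarrow> ereal c \<le> ord (A' i j)"
    and "\<And>i j. 1 \<le> i \<Longrightarrow> 1 \<le> j \<Longrightarrow> ereal B \<le> ord (A i j - A' i j)"
  shows "ereal (B + real k * c) \<le> ord (minor A S T - minor A' S T)"
proof -
  have "card S = k" using assms by (auto simp: index_sets_def)
  show ?thesis
    unfolding minor_def \<open>card S = k\<close>
    using assms sorted_list_of_index_set by (intro ord_det_diff_ge) auto
qed

end

text \<open>\<open>c\<close> bounds all entries at once, and being nonpositive it can be counted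
  once too often in any estimate. \<open>rows_ge\<close>, taken for all \<open>B\<close>, amounts to
  nuclearity.\<close>

locale nuclear_matrix = Cp_action p ord \<sigma> g
  for p :: nat and ord :: "'k :: {field_char_0, complete_space} \<Rightarrow> ereal" and \<sigma> g +
  fixes M :: "'k inf_matrix" and c :: real
  assumes c_le: "c \<le> 0"
    and entry_ge: "1 \<le> i \<Longrightarrow> 1 \<le> j \<Longrightarrow> ereal c \<le> ord (M i j)"
    and rows_ge: "\<exists>n. \<forall>i>n. \<forall>j\<ge>1. ereal B \<le> ord (M i j)"
begin

abbreviation P :: "nat \<Rightarrow> 'k inf_matrix" where "P \<equiv> twisted_product g M"
abbreviation Q :: "nat \<Rightarrow> nat \<Rightarrow> 'k inf_matrix" where "Q n \<equiv> truncated_product g M {1..n}"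

text \<open>Provides the finiteness premise of \<open>infsum_approx\<close> for an entry of a matrix
  product. \<open>N\<close> stands for a column of a twisted product, which inherits bounds on the
  rows of \<open>M\<close> up to the shift \<open>d\<close>.\<close>

lemma finite_entry_mult_less:
  assumes A: "\<And>l. 1 \<le> l \<Longrightarrow> ereal B \<le> ord (A l)"
    and N: "\<And>l B. 1 \<le> l \<Longrightarrow> (\<And>j. 1 \<le> j \<Longrightarrow> ereal B \<le> ord (M l j)) \<Longrightarrow> ereal (B + d) \<le> ord (N l)"
  shows "finite {l \<in> {1..}. ord (A l * N l) < ereal C}"
proof -
  obtain n where n: "\<forall>i>n. \<forall>j\<ge>1. ereal (C - B - d) \<le> ord (M i j)" using rows_ge by blast
  have "ereal C \<le> ord (A l * N l)" if "1 \<le> l" "l > n" for l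
    using ord_mult_ge[OF A[OF that(1)] N[OF that(1), of "C - B - d"]] n that by simp
  then have "{l \<in> {1..}. ord (A l * N l) < ereal C} \<subseteq> {..n}"
    by (auto simp: not_less[symmetric] simp del: not_less)
  then show ?thesis using finite_subset by blast
qed

text \<open>Row \<open>i\<close> only meets the leftmost factor, which contributes \<open>B\<close>;
  each of the other \<open>m\<close> factors contributes at least \<open>c\<close>.\<close>

lemma P_ge:
  assumes "1 \<le> i" "1 \<le> j" "\<And>j. 1 \<le> j \<Longrightarrow> ereal B \<le> ord (M i j)"
  shows "ereal (B + real m * c) \<le> ord (P m i j)"
  using assms
proof (induction m arbitrary: i j B)
  case (Suc m)
  define f where "f l = (g ^^ Suc m) (M i l) * P m l j" for l
  have A: "ereal B \<le> ord ((g ^^ Suc m) (M i l))" if "1 \<le> l" for l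
    using Suc.prems that unfolding ord_funpow_g by blast
  have N: "ereal (B + real m * c) \<le> ord (P m l j)"
    if "1 \<le> l" "\<And>j. 1 \<le> j \<Longrightarrow> ereal B \<le> ord (M l j)" for l B
    using that Suc by blast
  have "ereal (B + real (Suc m) * c) \<le> ord (f l)" if "1 \<le> l" for l
    unfolding f_def
    using ord_mult_ge[OF A N[of l c]] that entry_ge by (simp add: algebra_simps)
  moreover have "finite {l \<in> {1..}. ord (f l) < ereal C}" for C
    unfolding f_def by (rule finite_entry_mult_less[OF A N])
  \<comment> \<open>Approximation by the empty sum bounds the infinite sum itself.\<close>
  ultimately have "ereal (B + real (Suc m) * c) \<le> ord (infsum f {1..} - sum f {})"
    by (intro infsum_approx) auto
  then show ?case
    by (simp add: inf_matrix_mult_def map_inf_matrix_def f_def[abs_def])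
qed simp

lemma Q_ge: "1 \<le> i \<Longrightarrow> 1 \<le> j \<Longrightarrow> ereal (real (Suc m) * c) \<le> ord (Q n m i j)"
proof (induction m arbitrary: i j)
  case (Suc m)
  have "ereal (c + real (Suc m) * c) \<le> ord ((g ^^ Suc m) (M i l) * Q n m l j)"
    if "l \<in> {1..n}" for l
    using that Suc entry_ge by (intro ord_mult_ge) (auto simp del: funpow.simps)
  then have "ereal (c + real (Suc m) * c) \<le> ord (Q n (Suc m) i j)"
    unfolding truncated_product.simps by (rule ord_sum_ge)
  then show ?case by (simp add: algebra_simps)
qed (use entry_ge in simp)

text \<open>The omitted indices \<open>l > n\<close> are rows of \<open>M\<close> with bound
  \<open>B\<close>, which \<open>P_ge\<close> carries over to \<open>P m l j\<close>. On the indices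
  up to \<open>n\<close> the error is the one of the previous stage times an entry.\<close>

lemma P_diff_Q_ge:
  assumes n: "\<forall>i>n. \<forall>j\<ge>1. ereal B \<le> ord (M i j)" and "1 \<le> i" "1 \<le> j"
  shows "ereal (B + real m * c) \<le> ord (P m i j - Q n m i j)"
  using assms(2,3)
proof (induction m arbitrary: i j)
  case (Suc m)
  define f where "f l = (g ^^ Suc m) (M i l) * P m l j" for l
  have A: "ereal c \<le> ord ((g ^^ Suc m) (M i l))" if "1 \<le> l" for l
    using Suc.prems that entry_ge unfolding ord_funpow_g by blast
  have fin: "finite {l \<in> {1..}. ord (f l) < ereal C}" for C
    unfolding f_def by (rule finite_entry_mult_less[OF A P_ge[OF _ Suc.prems(2)]])
  have "ereal (c + (B + real m * c)) \<le> ord (infsum f {1..} - sum f {1..n})"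
  proof (rule infsum_approx[OF fin])
    fix l assume "l \<in> {1..} - {1..n}"
    then show "ereal (c + (B + real m * c)) \<le> ord (f l)"
      unfolding f_def using n Suc.prems by (intro ord_mult_ge A P_ge) auto
  qed auto
  moreover have "ereal (c + (B + real m * c)) \<le>
      ord (\<Sum>l\<in>{1..n}. (g ^^ Suc m) (M i l) * (P m l j - Q n m l j))"
    using Suc by (intro ord_sum_ge ord_mult_ge A) auto
  ultimately have "ereal (c + (B + real m * c)) \<le> ord ((infsum f {1..} - sum f {1..n}) +
      (\<Sum>l\<in>{1..n}. (g ^^ Suc m) (M i l) * (P m l j - Q n m l j)))"
    by (rule ord_add_ge)
  also have "(infsum f {1..} - sum f {1..n}) +
      (\<Sum>l\<in>{1..n}. (g ^^ Suc m) (M i l) * (P m l j - Q n m l j)) =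
      P (Suc m) i j - Q n (Suc m) i j"
    by (simp add: inf_matrix_mult_def map_inf_matrix_def f_def[abs_def] right_diff_distrib
        sum_subtractf del: funpow.simps)
  finally show ?case by (simp add: algebra_simps)
qed simp

text \<open>A row \<open>s > n\<close> of the minor gains \<open>B\<close>, and every other row is
  bounded by \<open>(m + 1) * c\<close>; that bound is counted \<open>k\<close> times instead of
  \<open>k - 1\<close>.\<close>

lemma minor_P_ge:
  assumes n: "\<forall>i>n. \<forall>j\<ge>1. ereal B \<le> ord (M i j)"
    and S: "S \<in> index_sets k" "\<not> S \<subseteq> {1..n}"
  shows "ereal (B + real m * c + real k * (real (Suc m) * c)) \<le> ord (minor (P m) S S)"
proof -
  obtain s where s: "s \<in> S" "s > n" using S by (auto simp: index_sets_def subset_eq not_le)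
  define C where "C = real (Suc m) * c"
  have "C \<le> 0" using c_le by (simp add: C_def mult_nonneg_nonpos)
  define r where "r i = C + (if i = s then B + real m * c - C else 0)" for i
  have "ereal (r i) \<le> ord (P m i j)" if "i \<in> S" "1 \<le> j" for i j
  proof -
    have "1 \<le> i" using that S by (auto simp: index_sets_def)
    have "ereal (c + real m * c) \<le> ord (P m i j)"
      using \<open>1 \<le> i\<close> that entry_ge by (intro P_ge) auto
    moreover have "ereal (B + real m * c) \<le> ord (P m i j)" if "i = s"
      using \<open>1 \<le> i\<close> \<open>1 \<le> j\<close> n s that by (intro P_ge) auto
    ultimately show ?thesis by (auto simp: r_def C_def algebra_simps)
  qed
  then have "ereal (\<Sum>i\<in>S. r i) \<le> ord (minor (P m) S S)"
    by (intro ord_minor_ge[OF S(1) S(1)]) auto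
  moreover have "(\<Sum>i\<in>S. r i) = real k * C + (B + real m * c - C)"
    using index_setsD[OF S(1)] s by (simp add: r_def sum.distrib sum.delta)
  ultimately show ?thesis
    using \<open>C \<le> 0\<close> unfolding C_def[symmetric] by (auto elim!: order_trans[rotated])
qed

text \<open>Two replacements: index sets not contained in \<open>{1..n}\<close> are dropped, and in
  the remaining finitely many minors \<open>P m\<close> gives way to \<open>Q n m\<close>.\<close>

lemma fredholm_coeff_approx:
  obtains n where "n \<ge> k"
    "ereal B \<le> ord (infsum (\<lambda>S. minor (P m) S S) (index_sets k) -
      (\<Sum>S | S \<subseteq> {1..n} \<and> card S = k. minor (Q n m) S S))"
proof -
  define C where "C = real (Suc m) * c"
  have "C \<le> 0" using c_le by (simp add: C_def mult_nonneg_nonpos)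
  have ex: "\<exists>n\<ge>k. \<forall>i>n. \<forall>j\<ge>1. ereal B \<le> ord (M i j)" for B
    using rows_ge[of B] by (metis max.cobounded1 max.strict_boundedE)
  have fin: "finite {S \<in> index_sets k. ord (minor (P m) S S) < ereal B}" for B
  proof -
    obtain n where n: "\<forall>i>n. \<forall>j\<ge>1. ereal (B - real m * c - real k * C) \<le> ord (M i j)"
      using ex by blast
    have "{S \<in> index_sets k. ord (minor (P m) S S) < ereal B} \<subseteq> Pow {1..n}"
      using minor_P_ge[OF n, of _ k m] by (force simp: C_def)
    then show ?thesis using finite_subset by blast
  qed
  \<comment> \<open>The threshold compensates the losses in \<open>minor_P_ge\<close> and in
    \<open>P_diff_Q_ge\<close> followed by \<open>ord_minor_diff_ge\<close>, leaving exactly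
    \<open>B\<close>.\<close>
  obtain n where n: "n \<ge> k" "\<forall>i>n. \<forall>j\<ge>1. ereal (B - real m * c - real k * C) \<le> ord (M i j)"
    using ex by blast
  let ?F = "{S. S \<subseteq> {1..n} \<and> card S = k}"
  have F: "finite ?F" "?F \<subseteq> index_sets k"
    by (auto simp: index_sets_def intro: finite_subset)
  have "ereal B \<le> ord (infsum (\<lambda>S. minor (P m) S S) (index_sets k) - (\<Sum>S\<in>?F. minor (P m) S S))"
  proof (rule infsum_approx[OF fin F])
    fix S assume "S \<in> index_sets k - ?F"
    then show "ereal B \<le> ord (minor (P m) S S)"
      using minor_P_ge[OF n(2), of S k m] by (auto simp: index_sets_def C_def)
  qed
  moreover have "ereal B \<le> ord ((\<Sum>S\<in>?F. minor (P m) S S) - (\<Sum>S\<in>?F. minor (Q n m) S S))"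
    unfolding sum_subtractf[symmetric]
  proof (rule ord_sum_ge)
    fix S assume "S \<in> ?F"
    then have S: "S \<in> index_sets k" using F by blast
    have "ereal (B - real k * C + real k * C) \<le> ord (minor (P m) S S - minor (Q n m) S S)"
    proof (rule ord_minor_diff_ge[OF S S \<open>C \<le> 0\<close>])
      fix i j :: nat assume ij: "1 \<le> i" "1 \<le> j"
      show "ereal C \<le> ord (P m i j)"
        using P_ge[OF ij, of c m] entry_ge ij by (simp add: C_def algebra_simps)
      show "ereal C \<le> ord (Q n m i j)"
        using Q_ge[OF ij] by (simp add: C_def)
      show "ereal (B - real k * C) \<le> ord (P m i j - Q n m i j)"
        using P_diff_Q_ge[OF n(2) ij, of m] by simp
    qed
    then show "ereal B \<le> ord (minor (P m) S S - minor (Q n m) S S)" by simp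
  qed
  ultimately show ?thesis
    using that[OF n(1)] ord_diff_trans by blast
qed

text \<open>Induction on the number of factors; the weights telescope along products of compound
  matrices. \<open>e\<close> is a real bound below both \<open>b\<close> and \<open>ord D\<close>,
  available also if \<open>D = 0\<close>. Every contribution other than the product of conjugates of
  \<open>D\<close> has one factor that supplies \<open>b\<close>, and each of the others supplies at
  least \<open>e\<close>.\<close>

lemma minor_Q_diff_ge:
  fixes h :: "nat \<Rightarrow> real" and k n :: nat and e :: real
  defines "K \<equiv> {1..k}" and "D \<equiv> minor M {1..k} {1..k}"
    and "b \<equiv> (\<Sum>i = 1..k. h i) + (h (k + 1) - h k) / 2"
    and "w \<equiv> (\<lambda>S. if S = {1..k} then 0 else (h (k + 1) - h k) / 2)"
  assumes h: "mono_on {1..} h" "\<And>i j. 1 \<le> i \<Longrightarrow> 1 \<le> j \<Longrightarrow> ereal (h i) \<le> ord (M i j)"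
    and k: "k \<ge> 1" "k \<le> n" and e: "e \<le> b" "ereal e \<le> ord D"
    and S: "S \<in> index_sets k" and T: "T \<in> index_sets k"
  shows "ereal (b + real m * e + w S - w T) \<le>
    ord (minor (Q n m) S T - (if S = K \<and> T = K then \<Prod>i\<le>m. (g ^^ i) D else 0))"
  using S T
proof (induction m arbitrary: S T)
  have mono: "h k \<le> h (k + 1)" using k by (intro monotone_onD[OF h(1)]) auto
  \<comment> \<open>With \<open>\<delta> = h (k + 1) - h k\<close>, the row \<open>S = K\<close>
    with \<open>T \<noteq> K\<close> requires only the sum of \<open>h\<close> over
    \<open>K\<close>. For \<open>S \<noteq> K\<close> the demand is largest at \<open>T = K\<close>,
    where it exceeds that sum by \<open>\<delta>\<close>.\<close>
  have base: "ereal (b + w S - w T) \<le> ord (minor M S T - (if S = K \<and> T = K then D else 0))"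
    if S: "S \<in> index_sets k" and T: "T \<in> index_sets k" for S T
  proof (cases "S = K \<and> T = K")
    case False
    have "ereal (\<Sum>i\<in>S. h i) \<le> ord (minor M S T)"
      using S by (intro ord_minor_ge[OF S T] h(2)) (auto simp: index_sets_def)
    moreover have "b + w S - w T \<le> (\<Sum>i\<in>S. h i)"
    proof (cases "S = {1..k}")
      case True
      then have "T \<noteq> {1..k}" using False by (simp add: K_def)
      then show ?thesis using True by (simp add: b_def w_def)
    next
      case S_neq: False
      have "b + w S - w T \<le> (\<Sum>i = 1..k. h i) + (h (k + 1) - h k)"
        unfolding b_def w_def if_not_P[OF S_neq] using mono by (simp add: field_simps)
      then show ?thesis using sum_initial_segment_le[OF h(1) S S_neq k(1)] by (rule order_trans)
    qed
    ultimately show ?thesis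
      using False by (auto elim!: order_trans[rotated])
  qed (simp add: D_def K_def)
  {
    case 0
    then show ?case using base[of S T] by (cases "S = K \<and> T = K") auto
  next
    case (Suc m)
    define G where "G = g ^^ Suc m"
    interpret G: comm_ring_hom G unfolding G_def by (rule comm_ring_hom_funpow_g)
    have ord_G: "ord (G x) = ord x" for x unfolding G_def by (rule ord_funpow_g)
    define A where "A S T = minor (\<lambda>i j. G (M i j)) S T" for S T
    define N where "N S T = minor (Q n m) S T" for S T
    define E where "E = (\<Prod>i\<le>m. (g ^^ i) D)"
    define W where "W = {U. U \<subseteq> {1..n} \<and> card U = k}"
    have W: "finite W" "W \<subseteq> index_sets k" "K \<in> W"
      using k by (auto simp: W_def index_sets_def K_def intro: finite_subset)
    have A_diff: "ereal (b + w S - w T) \<le> ord (A S T - (if S = K \<and> T = K then G D else 0))"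
      if "S \<in> index_sets k" "T \<in> index_sets k" for S T
    proof -
      have "A S T - (if S = K \<and> T = K then G D else 0) =
          G (minor M S T - (if S = K \<and> T = K then D else 0))"
        by (simp add: A_def G.minor_hom G.hom_minus)
      then show ?thesis using base[OF that] by (simp add: ord_G)
    qed
    have N_diff: "ereal (b + real m * e + w S - w T) \<le> ord (N S T - (if S = K \<and> T = K then E else 0))"
      if "S \<in> index_sets k" "T \<in> index_sets k" for S T
      unfolding N_def E_def by (rule Suc.IH[OF that])
    \<comment> \<open>The weaker bound absorbs \<open>E\<close>, whose \<open>m + 1\<close> factors
      each have valuation at least \<open>e\<close>; at \<open>(K, K)\<close> the weights
      cancel.\<close>
    have N_ge: "ereal (real (Suc m) * e + w S - w T) \<le> ord (N S T)"
      if "S \<in> index_sets k" "T \<in> index_sets k" for S T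
    proof -
      have "ereal (real (Suc m) * e + w S - w T) \<le> ereal (b + real m * e + w S - w T)"
        using e by (simp add: algebra_simps)
      then have "ereal (real (Suc m) * e + w S - w T) \<le>
          ord (N S T - (if S = K \<and> T = K then E else 0))"
        using N_diff[OF that] by (rule order_trans)
      moreover have "ereal (\<Sum>i\<le>m. e) \<le> ord E"
        unfolding E_def using e by (intro ord_prod_ge) simp
      then have "ereal (real (Suc m) * e + w S - w T) \<le> ord (if S = K \<and> T = K then E else 0)"
        by simp
      ultimately have "ereal (real (Suc m) * e + w S - w T) \<le>
          ord (N S T - (if S = K \<and> T = K then E else 0) + (if S = K \<and> T = K then E else 0))"
        by (rule ord_add_ge)
      then show ?thesis by simp
    qed
    have "minor (Q n (Suc m)) S T = (\<Sum>U\<in>W. A S U * N U T)"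
      unfolding A_def N_def W_def using index_setsD[OF Suc.prems(1)]
      by (simp add: minor_mult G_def del: funpow.simps)
    \<comment> \<open>The main part \<open>G D\<close> of the new factor sits at
      \<open>(K, K)\<close>, so it is seen only for \<open>S = U = K\<close>.\<close>
    also have "\<dots> = (\<Sum>U\<in>W. (A S U - (if S = K \<and> U = K then G D else 0)) * N U T) +
        (\<Sum>U\<in>W. if U = K then (if S = K then G D * N K T else 0) else 0)"
      unfolding sum.distrib[symmetric]
      by (intro sum.cong) (auto simp: algebra_simps)
    also have "(\<Sum>U\<in>W. if U = K then (if S = K then G D * N K T else 0) else 0) =
        (if S = K then G D * N K T else 0)"
      using W by (simp add: sum.delta)
    finally have "minor (Q n (Suc m)) S T - (if S = K \<and> T = K then \<Prod>i\<le>Suc m. (g ^^ i) D else 0) =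
        (\<Sum>U\<in>W. (A S U - (if S = K \<and> U = K then G D else 0)) * N U T) +
        (if S = K then G D * (N K T - (if K = K \<and> T = K then E else 0)) else 0)"
      by (simp add: E_def G_def algebra_simps del: funpow.simps)
    moreover have "ereal (b + real (Suc m) * e + w S - w T) \<le>
        ord (\<Sum>U\<in>W. (A S U - (if S = K \<and> U = K then G D else 0)) * N U T)"
    proof (rule ord_sum_ge)
      fix U assume "U \<in> W"
      then have "U \<in> index_sets k" using W by blast
      \<comment> \<open>Here the new factor supplies \<open>b\<close> and the old product
        \<open>(m + 1) * e\<close>; \<open>w U\<close> cancels.\<close>
      from ord_mult_ge[OF A_diff[OF Suc.prems(1) this] N_ge[OF this Suc.prems(2)]]
      show "ereal (b + real (Suc m) * e + w S - w T) \<le>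
          ord ((A S U - (if S = K \<and> U = K then G D else 0)) * N U T)"
        by (simp add: algebra_simps)
    qed
    moreover have "ereal (b + real (Suc m) * e + w S - w T) \<le>
        ord (if S = K then G D * (N K T - (if K = K \<and> T = K then E else 0)) else 0)"
    proof (cases "S = K")
      case True
      have "ereal (e + (b + real m * e + w K - w T)) \<le>
          ord (G D * (N K T - (if K = K \<and> T = K then E else 0)))"
        using Suc.prems True e by (intro ord_mult_ge N_diff) (auto simp: ord_G)
      then show ?thesis using True by (simp add: algebra_simps)
    qed simp
    ultimately show ?case by (simp only:) (rule ord_add_ge)
  }
qed

lemma ord_prod_funpow_g: "ord (\<Prod>i\<le>m. (g ^^ i) x) = ereal (real (Suc m)) * ord x"
proof -
  have "ord (\<Prod>i\<le>m. (g ^^ i) x) = ord (x ^ Suc m)"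
    by (induction m) (simp_all add: ord_mult ord_funpow_g ac_simps del: funpow.simps)
  then show ?thesis by (simp only: ord_power)
qed

text \<open>On the diagonal the weights cancel, and only \<open>S = {1..k}\<close> carries a main
  term. The truncation error is taken as small as the bound to be proved.\<close>

lemma fredholm_coeff_decomposition:
  fixes h :: "nat \<Rightarrow> real" and k m :: nat and e :: real
  defines "D \<equiv> minor M {1..k} {1..k}"
    and "b \<equiv> (\<Sum>i = 1..k. h i) + (h (k + 1) - h k) / 2"
  assumes h: "mono_on {1..} h" "\<And>i j. 1 \<le> i \<Longrightarrow> 1 \<le> j \<Longrightarrow> ereal (h i) \<le> ord (M i j)"
    and k: "k \<ge> 1" and e: "e \<le> b" "ereal e \<le> ord D"
  shows "ereal (b + real m * e) \<le>
    ord (infsum (\<lambda>S. minor (P m) S S) (index_sets k) - (\<Prod>i\<le>m. (g ^^ i) D))"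
proof -
  obtain n where n: "n \<ge> k"
    "ereal (b + real m * e) \<le> ord (infsum (\<lambda>S. minor (P m) S S) (index_sets k) -
      (\<Sum>S | S \<subseteq> {1..n} \<and> card S = k. minor (Q n m) S S))"
    using fredholm_coeff_approx by blast
  let ?F = "{S. S \<subseteq> {1..n} \<and> card S = k}"
  have F: "finite ?F" "{1..k} \<in> ?F" using n by auto
  have "ereal (b + real m * e) \<le> ord (\<Sum>S\<in>?F. minor (Q n m) S S -
      (if S = {1..k} \<and> S = {1..k} then \<Prod>i\<le>m. (g ^^ i) D else 0))"
  proof (rule ord_sum_ge)
    fix S assume "S \<in> ?F"
    then have "S \<in> index_sets k" by (auto simp: index_sets_def intro: finite_subset)
    from minor_Q_diff_ge[OF h k n(1) e[unfolded b_def D_def] this this, of m]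
    show "ereal (b + real m * e) \<le> ord (minor (Q n m) S S -
        (if S = {1..k} \<and> S = {1..k} then \<Prod>i\<le>m. (g ^^ i) D else 0))"
      by (simp only: b_def D_def add_diff_cancel_right')
  qed
  also have "(\<Sum>S\<in>?F. minor (Q n m) S S -
      (if S = {1..k} \<and> S = {1..k} then \<Prod>i\<le>m. (g ^^ i) D else 0)) =
      (\<Sum>S\<in>?F. minor (Q n m) S S) - (\<Prod>i\<le>m. (g ^^ i) D)"
    using F by (simp add: sum_subtractf sum.delta)
  finally show ?thesis using n(2) ord_diff_trans by blast
qed

end

section \<open>Comparison of \<open>ord C\<close> with the valuation of the leading minor\<close>

theorem theorem5p5:
  fixes p a k :: nat
    and ord :: "'k :: {field_char_0, complete_space} \<Rightarrow> ereal"
    and M :: "'k inf_matrix"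
    and \<sigma> g :: "'k \<Rightarrow> 'k"
    and h :: "nat \<Rightarrow> real"
    and C :: 'k
  assumes Cp: "padic_complex_numbers p ord"
    and nuclear: "nuclear ord M"
    and galois: "galois_Qp \<sigma>"
    and action: "is_Cp_action \<sigma> g"
    and a: "a \<ge> 1"
    and k: "k \<ge> 1"
    and C: "C = fps_nth (fredholm_det (twisted_product g M (a - 1))) k"
    and h_mono: "mono_on {1..} h"
    and h_le: "\<And>i. i \<ge> 1 \<Longrightarrow> ereal (h i) \<le> row_ord ord M i"
  shows
    "let b = ereal ((\<Sum>i = 1..k. h i) + (h (k + 1) - h k) / 2);
         d = ord (det (leading_submatrix M k));
         c = ord C / ereal (real a)
     in (d < b \<longleftrightarrow> c < b) \<and> (d < b \<longrightarrow> c = d) \<and> (c < b \<longrightarrow> c = d)"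
proof -
  interpret Cp_action p ord \<sigma> g
    using Cp galois action by (simp add: Cp_action_def Cp_action_axioms_def)
  have M_ge_row: "row_ord ord M i \<le> ord (M i j)" if "1 \<le> j" for i j
    unfolding row_ord_def using that by (intro INF_lower) auto
  have h_ge: "ereal (h i) \<le> ord (M i j)" if "1 \<le> i" "1 \<le> j" for i j
    using h_le M_ge_row that order_trans by blast
  \<comment> \<open>As \<open>h\<close> is nondecreasing, \<open>h 1\<close> bounds every entry; the
    minimum with 0 makes the constant nonpositive.\<close>
  interpret nuclear_matrix p ord \<sigma> g M "min 0 (h 1)"
  proof
    show "ereal (min 0 (h 1)) \<le> ord (M i j)" if "1 \<le> i" "1 \<le> j" for i j
    proof -
      have "min 0 (h 1) \<le> h i"
        using monotone_onD[OF h_mono, of 1 i] that by auto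
      then show ?thesis using h_ge[OF that] order_trans ereal_less_eq(3) by blast
    qed
    show "\<exists>n. \<forall>i>n. \<forall>j\<ge>1. ereal B \<le> ord (M i j)" for B
    proof -
      obtain n where n: "\<And>i. i \<ge> n \<Longrightarrow> ereal B < row_ord ord M i"
        using nuclear unfolding nuclear_def tendsto_PInfty eventually_sequentially by blast
      then have "ereal B \<le> ord (M i j)" if "i > n" "j \<ge> 1" for i j
        using less_le_trans[OF n[of i] M_ge_row[of j i]] that by simp
      then show ?thesis by blast
    qed
  qed simp
  define b where "b = (\<Sum>i = 1..k. h i) + (h (k + 1) - h k) / 2"
  define D where "D = det (leading_submatrix M k)"
  define X where "X = infsum (\<lambda>S. minor (P (a - 1)) S S) (index_sets k)"
  define E where "E = (\<Prod>i\<le>a - 1. (g ^^ i) D)"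
  have a_pos: "0 < real a" and Suc_a: "real (a - 1) = real a - 1" using a by auto
  have "C = (- 1) ^ k * X"
    by (simp add: C X_def fredholm_det_def det_principal_submatrix index_sets_def)
  then have ord_C: "ord C = ord X" by (simp add: minus_one_power_iff)
  have ord_E: "ord E = ereal (real a) * ord D"
    using ord_prod_funpow_g[where m = "a - 1" and x = D] a by (simp add: E_def)
  have X_diff: "ereal (b + (real a - 1) * e) \<le> ord (X - E)" if "e \<le> b" "ereal e \<le> ord D" for e
    using fredholm_coeff_decomposition[OF h_mono h_ge k, where m = "a - 1" and e = e] that
    unfolding b_def D_def X_def E_def det_leading_submatrix Suc_a by blast
  \<comment> \<open>These two implications suffice: the second, by contraposition, leads from
    \<open>c < b\<close> back to \<open>d < b\<close>.\<close>
  have "(ord D < ereal b \<longrightarrow> ord C / ereal (real a) = ord D) \<and>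
    (\<not> ord D < ereal b \<longrightarrow> ereal b \<le> ord C / ereal (real a))"
  proof (intro conjI impI)
    assume less: "ord D < ereal b"
    \<comment> \<open>With \<open>e = ord D < b\<close>, the error has valuation at least
      \<open>b + (a - 1) * e\<close>, above \<open>ord E = a * e\<close>.\<close>
    then obtain e where e: "ord D = ereal e" "e < b"
      using ord_not_MInfty[of D] by (cases "ord D") auto
    have "ord E < ereal (b + (real a - 1) * e)"
      using e by (simp add: ord_E algebra_simps)
    also have "\<dots> \<le> ord (X - E)" using e by (intro X_diff) auto
    finally have "ord X = ord E" by (rule ord_eqI)
    then show "ord C / ereal (real a) = ord D"
      using e a_pos by (simp add: ord_C ord_E)
  next
    assume "\<not> ord D < ereal b"
    then have ge: "ereal b \<le> ord D" by simp
    \<comment> \<open>Now \<open>e = b\<close>, and both the error and \<open>E\<close> reach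
      \<open>a * b\<close>.\<close>
    have "ereal (real a * b) \<le> ord (X - E)"
      using X_diff[OF order_refl ge] by (simp add: algebra_simps)
    moreover have "ereal (real a * b) \<le> ord E"
      unfolding ord_E times_ereal.simps(1)[symmetric] using ge by (intro ereal_mult_left_mono) auto
    ultimately have "ereal (real a * b) \<le> ord (X - E + E)"
      by (rule ord_add_ge)
    then have "ereal b * ereal (real a) \<le> ord X" by (simp add: mult.commute)
    then show "ereal b \<le> ord C / ereal (real a)"
      unfolding ord_C using a_pos by (subst ereal_le_divide_pos) (auto simp: mult.commute)
  qed
  then show ?thesis
    unfolding Let_def b_def[symmetric] D_def[symmetric] by (metis not_le)
qed

end
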